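(* There is an $\mathrm{O}(\log N)$-pass streaming algorithm with $\mathrm{O}(\log^2 N)$ space, $\mathrm{O}(\log N)$ processing time per letter and $3$ auxiliary read/write streams which, given on its input stream $\mathrm{XML}(\mathrm{FCNS}(t))$ for any tree $t$ with $N$ nodes, computes $\mathrm{XML}(t)$ on the third auxiliary stream.
   Context: Trees: finite rooted ordered (unranked) trees whose nodes are labeled by letters of a finite alphabet $\Sigma$. For each label $a$ there is an opening tag $a$ and a closing tag $\bar a$; $\mathrm{XML}(t)$ is the sequence of tags of a depth-first left-to-right traversal (opening tag on entering a node, closing tag on leaving it). The First-Child-Next-Sibling encoding $\mathrm{FCNS}(t)$ is the tree on the same node set, with the same root, where the left child of $v$ is its first child in $t$ (if any) and the right child of $v$ is its next sibling in $t$ (if any); each node is labeled $a_L$ if it is a left child (the root by convention) and $a_R$ if it is a right child, $a$ being its label in $t$; $\mathrm{XML}(\mathrm{FCNS}(t))$ is its XML sequence with annotated tags. Streaming model with external memory: internal memory (the space, in letters and bits) plus auxiliary read/write streams with sequential access, each cell holding a letter or a constant-size tuple of letters and integers in $[0,2N]$; each pass on an auxiliary stream is a read or a write pass, and passes may go in either direction; the number of passes counts all passes over input and auxiliary streams; processing time per letter is the maximal running time between two consecutive read/write operations, arithmetic on integers in $[0,2N]$ taking constant time. *)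

theory Defs
  imports Complex_Main "HOL-Library.Tree" "HOL-Library.Landau_Symbols"
begin

section \<open>Trees and their XML sequences\<close>

datatype 'a utree = UNode 'a "'a utree list"

primrec nodes :: "'a utree \<Rightarrow> nat" where
  "nodes (UNode a ts) = Suc (sum_list (map nodes ts))"

datatype 'a tag = Opening 'a | Closing 'a

primrec xml :: "'a utree \<Rightarrow> 'a tag list" where
  "xml (UNode a ts) = Opening a # concat (map xml ts) @ [Closing a]"

primrec xml_bin :: "'a tree \<Rightarrow> 'a tag list" where
  "xml_bin \<langle>\<rangle> = []"
| "xml_bin \<langle>l, a, r\<rangle> = Opening a # xml_bin l @ xml_bin r @ [Closing a]"

datatype side = LeftChild | RightChild

text \<open>\<open>fcns_forest d ts\<close> encodes a list \<open>ts\<close> of consecutive siblings; its root is the first of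
  them, standing on side \<open>d\<close> of its parent in the encoding. An empty binary tree stands for a
  missing child.\<close>

fun fcns_forest :: "side \<Rightarrow> 'a utree list \<Rightarrow> ('a \<times> side) tree" where
  "fcns_forest d [] = \<langle>\<rangle>"
| "fcns_forest d (UNode a ts # us) =
     \<langle>fcns_forest LeftChild ts, (a, d), fcns_forest RightChild us\<rangle>"

definition fcns :: "'a utree \<Rightarrow> ('a \<times> side) tree" where
  "fcns t = fcns_forest LeftChild [t]"

instance side :: finite
proof
  have "(UNIV :: side set) \<subseteq> {LeftChild, RightChild}"
    using side.exhaust by blast
  then show "finite (UNIV :: side set)" by (rule finite_subset) simp
qed

instance tag :: (finite) finite
proof
  have "(x :: 'a tag) \<in> range Opening \<union> range Closing" for x
    by (cases x) auto
  then have "(UNIV :: 'a tag set) \<subseteq> range Opening \<union> range Closing" by blast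
  then show "finite (UNIV :: 'a tag set)" by (rule finite_subset) simp
qed


section \<open>Streaming machines with external memory\<close>

text \<open>
  An algorithm is a program of a small imperative language over a finite alphabet \<open>'c\<close>. The internal
  memory is an array of cells, each holding one letter or one number. Stream 0 is the read-only
  input stream, streams 1, ..., k are the auxiliary streams. A stream cell holds a tuple of letters
  and numbers; its width is that of the \<open>Write\<close> command that wrote it, hence bounded by
  a constant of the program.
\<close>

datatype 'c item = Sym 'c | Num nat

type_synonym 'c cell = "'c item list"

datatype direction = Forward | Backward

text \<open>\<open>Reading cs\<close>: a read pass is in progress and \<open>cs\<close> are the cells still ahead of the head, in
  the order in which the pass meets them.\<close>

datatype 'c mode = Closed | Reading "'c cell list" | Writing direction

record 'c stream =
  content :: "'c cell list"
  mode :: "'c mode"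

text \<open>\<open>top\<close> is the number of memory cells spanned so far (it never decreases), \<open>passes\<close> the number
  of passes begun on any stream, \<open>clock\<close> the number of elementary steps since the last
  read or write of a stream cell, and \<open>delay\<close> the maximum of \<open>clock\<close> so far.\<close>

record 'c state =
  mem :: "nat \<Rightarrow> 'c item"
  top :: nat
  streams :: "nat \<Rightarrow> 'c stream"
  passes :: nat
  clock :: nat
  delay :: nat

text \<open>\<open>Indexed b m x\<close> is the cell with address \<open>b + m * i\<close>, where \<open>i\<close> is the number in cell \<open>x\<close>;
  with different \<open>b < m\<close> this gives several interleaved arrays of unbounded length.\<close>

datatype place = Cell nat | Indexed nat nat nat

datatype 'c operand = Const "'c item" | At place

datatype arith = Add | Sub | Mul | Div | Mod

text \<open>Since \<open>'c\<close> is finite, the set in \<open>IsIn\<close> and the function in \<open>Translate\<close> below are finite tables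
  of the program.\<close>

datatype 'c cond =
    Equal "'c operand" "'c operand"
  | Less "'c operand" "'c operand"
  | IsIn "'c operand" "'c set"
  | AtEnd nat
  | Neg "'c cond"
  | Conj "'c cond" "'c cond"

datatype 'c prog =
    Skip
  | Assign place "'c operand"
  | Compute place arith "'c operand" "'c operand"
  | Translate place "'c \<Rightarrow> 'c" "'c operand"
  | OpenRead nat direction
  | OpenWrite nat direction
  | Read nat "place list"
  | Write nat "'c operand list"
  | Seq "'c prog" "'c prog"
  | If "'c cond" "'c prog" "'c prog"
  | While "'c cond" "'c prog"

primrec num_of :: "'c item \<Rightarrow> nat" where
  "num_of (Sym c) = 0"
| "num_of (Num n) = n"

primrec addr :: "'c state \<Rightarrow> place \<Rightarrow> nat" where
  "addr s (Cell x) = x"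
| "addr s (Indexed b m x) = b + m * num_of (mem s x)"

primrec val :: "'c state \<Rightarrow> 'c operand \<Rightarrow> 'c item" where
  "val s (Const v) = v"
| "val s (At l) = mem s (addr s l)"

primrec arith_op :: "arith \<Rightarrow> nat \<Rightarrow> nat \<Rightarrow> nat" where
  "arith_op Add m n = m + n"
| "arith_op Sub m n = m - n"
| "arith_op Mul m n = m * n"
| "arith_op Div m n = m div n"
| "arith_op Mod m n = m mod n"

primrec holds :: "'c state \<Rightarrow> 'c cond \<Rightarrow> bool" where
  "holds s (Equal e f) \<longleftrightarrow> val s e = val s f"
| "holds s (Less e f) \<longleftrightarrow> num_of (val s e) < num_of (val s f)"
| "holds s (IsIn e A) \<longleftrightarrow> val s e \<in> Sym ` A"
| "holds s (AtEnd i) \<longleftrightarrow> mode (streams s i) = Reading []"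
| "holds s (Neg b) \<longleftrightarrow> \<not> holds s b"
| "holds s (Conj b b') \<longleftrightarrow> holds s b \<and> holds s b'"

definition put :: "place \<Rightarrow> 'c item \<Rightarrow> 'c state \<Rightarrow> 'c state" where
  "put l v s = s\<lparr>mem := (mem s)(addr s l := v), top := max (top s) (Suc (addr s l))\<rparr>"

definition set_stream :: "nat \<Rightarrow> 'c stream \<Rightarrow> 'c state \<Rightarrow> 'c state" where
  "set_stream i S s = s\<lparr>streams := (streams s)(i := S)\<rparr>"

definition tick :: "'c state \<Rightarrow> 'c state" where
  "tick s = s\<lparr>clock := Suc (clock s), delay := max (delay s) (Suc (clock s))\<rparr>"

definition new_pass :: "'c state \<Rightarrow> 'c state" where
  "new_pass s = s\<lparr>passes := Suc (passes s)\<rparr>"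

definition reset_clock :: "'c state \<Rightarrow> 'c state" where
  "reset_clock s = s\<lparr>clock := 0\<rparr>"

definition in_direction :: "direction \<Rightarrow> 'b list \<Rightarrow> 'b list" where
  "in_direction d xs = (case d of Forward \<Rightarrow> xs | Backward \<Rightarrow> rev xs)"

definition add_cell :: "direction \<Rightarrow> 'c cell \<Rightarrow> 'c cell list \<Rightarrow> 'c cell list" where
  "add_cell d c cs = (case d of Forward \<Rightarrow> cs @ [c] | Backward \<Rightarrow> c # cs)"

primrec fits :: "nat \<Rightarrow> 'c item \<Rightarrow> bool" where
  "fits B (Sym c) \<longleftrightarrow> True"
| "fits B (Num n) \<longleftrightarrow> n \<le> B"

text \<open>
  \<open>exec k B P s s'\<close>: started in \<open>s\<close>, the program \<open>P\<close> terminates in \<open>s'\<close>, having used only the auxiliary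
  streams 1, ..., k and having stored, in memory and on streams, only numbers in \<open>{0..B}\<close>. A run
  that attempts anything else, or reads past the end of a stream, is stuck and has no final state.
  The bound \<open>B\<close> is not accessible to the program. A write pass discards the previous content of
  the stream; a backward write pass lays down cells from right to left.
\<close>

inductive exec :: "nat \<Rightarrow> nat \<Rightarrow> 'c::finite prog \<Rightarrow> 'c state \<Rightarrow> 'c state \<Rightarrow> bool"
  for k B :: nat where
  Skip: "exec k B Skip s (tick s)"
| Assign: "v = val s e \<Longrightarrow> fits B v \<Longrightarrow>
    exec k B (Assign l e) s (put l v (tick s))"
| Compute: "val s e = Num m \<Longrightarrow> val s f = Num n \<Longrightarrow> v = arith_op a m n \<Longrightarrow> v \<le> B \<Longrightarrow>
    exec k B (Compute l a e f) s (put l (Num v) (tick s))"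
| Translate: "val s e = Sym c \<Longrightarrow>
    exec k B (Translate l g e) s (put l (Sym (g c)) (tick s))"
| OpenRead: "i \<le> k \<Longrightarrow> xs = content (streams s i) \<Longrightarrow>
    exec k B (OpenRead i d) s
      (set_stream i \<lparr>content = xs, mode = Reading (in_direction d xs)\<rparr> (new_pass (tick s)))"
| OpenWrite: "0 < i \<Longrightarrow> i \<le> k \<Longrightarrow>
    exec k B (OpenWrite i d) s
      (set_stream i \<lparr>content = [], mode = Writing d\<rparr> (new_pass (tick s)))"
| Read: "mode (streams s i) = Reading (c # cs) \<Longrightarrow> length ls = length c \<Longrightarrow>
    exec k B (Read i ls) s
      (fold (\<lambda>(l, v). put l v) (zip ls c)
        (set_stream i \<lparr>content = content (streams s i), mode = Reading cs\<rparr> (reset_clock s)))"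
| Write: "mode (streams s i) = Writing d \<Longrightarrow> c = map (val s) es \<Longrightarrow> list_all (fits B) c \<Longrightarrow>
    exec k B (Write i es) s
      (set_stream i \<lparr>content = add_cell d c (content (streams s i)), mode = Writing d\<rparr>
        (reset_clock s))"
| Seq: "exec k B P s s' \<Longrightarrow> exec k B Q s' s'' \<Longrightarrow> exec k B (Seq P Q) s s''"
| IfTrue: "holds s b \<Longrightarrow> exec k B P (tick s) s' \<Longrightarrow> exec k B (If b P Q) s s'"
| IfFalse: "\<not> holds s b \<Longrightarrow> exec k B Q (tick s) s' \<Longrightarrow> exec k B (If b P Q) s s'"
| WhileFalse: "\<not> holds s b \<Longrightarrow> exec k B (While b P) s (tick s)"
| WhileTrue: "holds s b \<Longrightarrow> exec k B P (tick s) s' \<Longrightarrow> exec k B (While b P) s' s'' \<Longrightarrow>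
    exec k B (While b P) s s''"

inductive_cases exec_elims:
  "exec k B Skip s s'"
  "exec k B (Assign l e) s s'"
  "exec k B (Compute l a e f) s s'"
  "exec k B (Translate l g e) s s'"
  "exec k B (OpenRead i d) s s'"
  "exec k B (OpenWrite i d) s s'"
  "exec k B (Read i ls) s s'"
  "exec k B (Write i es) s s'"
  "exec k B (Seq P Q) s s'"
  "exec k B (If b P Q) s s'"
  "exec k B (While b P) s s'"

lemma exec_deterministic: "exec k B P s s' \<Longrightarrow> exec k B P s s'' \<Longrightarrow> s' = s''"
proof (induction arbitrary: s'' rule: exec.induct)
  case (Seq P s s1 Q s2)
  from Seq.prems show ?case by (rule exec_elims) (metis Seq.IH)
next
  case (IfTrue s b P s1 Q)
  from IfTrue.prems show ?case by (rule exec_elims) (use IfTrue in blast)+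
next
  case (IfFalse s b Q s1 P)
  from IfFalse.prems show ?case by (rule exec_elims) (use IfFalse in blast)+
next
  case (WhileFalse s b P)
  from WhileFalse.prems show ?case by (rule exec_elims) (use WhileFalse in blast)+
next
  case (WhileTrue s b P s1 s2)
  from WhileTrue.prems show ?case
    by (rule exec_elims) (use WhileTrue.hyps in blast, metis WhileTrue.IH)
qed (erule exec_elims; force)+

definition initial :: "'c cell list \<Rightarrow> 'c state" where
  "initial xs =
     \<lparr>mem = (\<lambda>_. Num 0), top = 0,
      streams = (\<lambda>i. \<lparr>content = (if i = 0 then xs else []), mode = Closed\<rparr>),
      passes = 0, clock = 0, delay = 0\<rparr>"

text \<open>A memory cell is charged for both kinds of content: one letter, and the bits of a number
  in \<open>{0..B}\<close>.\<close>

definition space :: "nat \<Rightarrow> 'c state \<Rightarrow> nat" where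
  "space B s = top s * (1 + nat \<lceil>log 2 (real (B + 1))\<rceil>)"

text \<open>
  \<open>streaming_algorithm P k p sp \<tau> I sz inp j out\<close>: on every instance \<open>x \<in> I\<close> of size \<open>N = sz x\<close>, the
  program \<open>P\<close> with \<open>k\<close> auxiliary streams and numbers in \<open>{0..2 * N}\<close>, given \<open>inp x\<close> on the input stream,
  halts with exactly \<open>out x\<close> on stream \<open>j\<close>, within \<open>p N\<close> passes, space \<open>sp N\<close> and processing
  time \<open>\<tau> N\<close> per letter.
\<close>

definition streaming_algorithm ::
    "'c::finite prog \<Rightarrow> nat \<Rightarrow> (nat \<Rightarrow> real) \<Rightarrow> (nat \<Rightarrow> real) \<Rightarrow> (nat \<Rightarrow> real) \<Rightarrow>
     'x set \<Rightarrow> ('x \<Rightarrow> nat) \<Rightarrow> ('x \<Rightarrow> 'c list) \<Rightarrow> nat \<Rightarrow> ('x \<Rightarrow> 'c list) \<Rightarrow> bool" where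
  "streaming_algorithm P k p sp \<tau> I sz inp j out \<longleftrightarrow>
     (\<forall>x\<in>I. let N = sz x; B = 2 * N in
        \<exists>s. exec k B P (initial (map (\<lambda>c. [Sym c]) (inp x))) s \<and>
            content (streams s j) = map (\<lambda>c. [Sym c]) (out x) \<and>
            real (passes s) \<le> p N \<and>
            real (space B s) \<le> sp N \<and>
            real (delay s) \<le> \<tau> N)"

text \<open>The letters are the annotated tags of the encoding and the tags of the decoded tree.\<close>

type_synonym 'a letter = "('a \<times> side) tag + 'a tag"

end

(*
  Opening tags occur in the same order in XML(t) and in XML(FCNS(t)), and the closing tag of a node v
  of t belongs between the two subtrees of v in FCNS(t). A single scan recognises these places, but
  when v has both children it no longer knows the label of v. It does know the depth of v in
  FCNS(t), and among the tags of a fixed depth opening and closing ones alternate. So the scan emits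
  the tags with their depth and position, closing tags without label; after a stable sort by depth
  every closing tag copies the label of its predecessor; a second sort by position yields XML(t).
  Both sorts are radix sorts on the bits of the keys, from the least significant one, that distribute
  stream 1 over streams 2 and 3 and concatenate these again: six passes for each bit. A constant
  number of memory cells and of steps per letter suffices.
*)

theory Submission
  imports Defs "HOL-Library.Multiset" "HOL-Real_Asymp.Real_Asymp"
begin

section \<open>Running programs\<close>

text \<open>Total correctness: \<open>exec\<close> is deterministic and stuck runs have no final
  state. The equivalences below turn it into a weakest precondition that the simplifier
  computes.\<close>

definition runs :: "nat \<Rightarrow> nat \<Rightarrow> 'c::finite prog \<Rightarrow> 'c state \<Rightarrow> ('c state \<Rightarrow> bool) \<Rightarrow> bool" where
  "runs k B P s R \<longleftrightarrow> (\<exists>s'. exec k B P s s' \<and> R s')"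

text \<open>Keeps the simplifier from rewriting the postcondition before the state it is applied to is
  known; programs are thus executed symbolically from front to back.\<close>

lemma runs_cong [cong]: "s = t \<Longrightarrow> runs k B P s R \<longleftrightarrow> runs k B P t R"
  by simp

lemma runs_mono: "runs k B P s Q \<Longrightarrow> (\<And>s'. Q s' \<Longrightarrow> R s') \<Longrightarrow> runs k B P s R"
  unfolding runs_def by blast

lemma runs_SeqI:
  "runs k B P s S \<Longrightarrow> (\<And>s'. S s' \<Longrightarrow> runs k B Q s' R) \<Longrightarrow> runs k B (Seq P Q) s R"
  unfolding runs_def by (blast intro: exec.Seq)

lemma runs_Skip: "runs k B Skip s R \<longleftrightarrow> R (tick s)"
  unfolding runs_def by (auto intro: exec.intros elim: exec_elims)

lemma runs_Assign:
  "runs k B (Assign l e) s R \<longleftrightarrow> fits B (val s e) \<and> R (put l (val s e) (tick s))"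
  unfolding runs_def by (auto intro: exec.intros elim: exec_elims)

lemma runs_Compute:
  assumes "val s e = Num m" and "val s f = Num n"
  shows "runs k B (Compute l a e f) s R \<longleftrightarrow>
     arith_op a m n \<le> B \<and> R (put l (Num (arith_op a m n)) (tick s))"
  using assms unfolding runs_def by (fastforce intro: exec.intros elim: exec_elims)

lemma runs_Translate:
  assumes "val s e = Sym c"
  shows "runs k B (Translate l g e) s R \<longleftrightarrow> R (put l (Sym (g c)) (tick s))"
  using assms unfolding runs_def by (fastforce intro: exec.intros elim: exec_elims)

lemma runs_OpenRead:
  "runs k B (OpenRead i d) s R \<longleftrightarrow> i \<le> k \<and>
     R (set_stream i \<lparr>content = content (streams s i),
          mode = Reading (in_direction d (content (streams s i)))\<rparr> (new_pass (tick s)))"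
  unfolding runs_def by (auto intro: exec.intros elim: exec_elims)

lemma runs_OpenWrite:
  "runs k B (OpenWrite i d) s R \<longleftrightarrow> 0 < i \<and> i \<le> k \<and>
     R (set_stream i \<lparr>content = [], mode = Writing d\<rparr> (new_pass (tick s)))"
  unfolding runs_def by (auto intro: exec.intros elim: exec_elims)

lemma runs_Read:
  assumes "mode (streams s i) = Reading (c # cs)" and "length ls = length c"
  shows "runs k B (Read i ls) s R \<longleftrightarrow>
     R (fold (\<lambda>(l, v). put l v) (zip ls c)
       (set_stream i \<lparr>content = content (streams s i), mode = Reading cs\<rparr> (reset_clock s)))"
  using assms unfolding runs_def by (fastforce intro: exec.Read elim: exec_elims)

lemma runs_Write:
  assumes "mode (streams s i) = Writing d"
  shows "runs k B (Write i es) s R \<longleftrightarrow> list_all (fits B) (map (val s) es) \<and>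
     R (set_stream i \<lparr>content = add_cell d (map (val s) es) (content (streams s i)),
       mode = Writing d\<rparr> (reset_clock s))"
  using assms unfolding runs_def by (fastforce intro: exec.Write elim: exec_elims)

lemma runs_Seq: "runs k B (Seq P Q) s R \<longleftrightarrow> runs k B P s (\<lambda>s'. runs k B Q s' R)"
  unfolding runs_def by (blast intro: exec.intros elim: exec_elims)

lemma runs_If:
  "runs k B (If b P Q) s R \<longleftrightarrow>
     (if holds s b then runs k B P (tick s) R else runs k B Q (tick s) R)"
  unfolding runs_def by (auto intro: exec.intros elim: exec_elims)

lemma runs_While_False: "\<not> holds s b \<Longrightarrow> R (tick s) \<Longrightarrow> runs k B (While b P) s R"
  unfolding runs_def by (blast intro: exec.intros)

lemma runs_While_True:
  "holds s b \<Longrightarrow> runs k B P (tick s) (\<lambda>s'. runs k B (While b P) s' R) \<Longrightarrow>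
     runs k B (While b P) s R"
  unfolding runs_def by (blast intro: exec.intros)

text \<open>The list indexes the invariant and is at the same time the termination measure. In every
  use it is the list of cells still ahead of the reading head.\<close>

lemma runs_While_list:
  assumes "I xs s"
    and "\<And>x xs s. I (x # xs) s \<Longrightarrow> holds s b \<and> runs k B P (tick s) (I xs)"
    and "\<And>s. I [] s \<Longrightarrow> \<not> holds s b \<and> R (tick s)"
  shows "runs k B (While b P) s R"
  using assms(1)
proof (induction xs arbitrary: s)
  case Nil
  then show ?case using assms(3) by (blast intro: runs_While_False)
next
  case (Cons x xs)
  show ?case
    using assms(2)[OF Cons.prems] Cons.IH by (blast intro: runs_While_True runs_mono)
qed

lemmas runs_simps = runs_Skip runs_Assign runs_Compute runs_Translate runs_OpenRead
  runs_OpenWrite runs_Read runs_Write runs_Seq runs_If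

lemmas state_simps = put_def tick_def set_stream_def new_pass_def reset_clock_def
  in_direction_def add_cell_def

text \<open>Conditional rules on nested maxima, such as those built up in \<open>delay\<close>, make the simplifier
  exponential.\<close>

declare max.absorb1 [simp del] max.absorb2 [simp del] max.absorb3 [simp del] max.absorb4 [simp del]

text \<open>The resource bounds carried through all proofs. The programs use cells 0 to 6 only,
  hence 7; 40 generously exceeds every stretch without stream access. The clock has its own bound
  \<open>c\<close> because such a stretch may cross the border between two program parts.\<close>

definition calm :: "nat \<Rightarrow> nat \<Rightarrow> 'c state \<Rightarrow> bool" where
  "calm c n s \<longleftrightarrow> top s \<le> 7 \<and> delay s \<le> 40 \<and> clock s \<le> c \<and> passes s = n"


section \<open>Sorting a stream by radix\<close>

text \<open>The first number is the key of the current sort, which the sort destroys; the second,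
  the position of the tag, is carried along.\<close>

type_synonym 'c entry = "nat \<times> nat \<times> 'c"

fun enc :: "'c entry \<Rightarrow> 'c cell" where
  "enc (k, x, c) = [Num k, Num x, Sym c]"

abbreviation entry_cells :: "place list" where
  "entry_cells \<equiv> [Cell 3, Cell 4, Cell 5]"

abbreviation entry_operands :: "'c operand list" where
  "entry_operands \<equiv> map At entry_cells"

text \<open>The write pass on stream 1 is opened outside, so that two such loops in a row
  concatenate streams 2 and 3.\<close>

definition copy_loop :: "nat \<Rightarrow> 'c prog" where
  "copy_loop i = While (Neg (AtEnd i)) (Seq (Read i entry_cells) (Write 1 entry_operands))"

text \<open>The key is halved once its lowest bit is in cell 6, so every pass inspects the lowest
  bit of what is left.\<close>

definition partition_loop :: "'c prog" where
  "partition_loop = While (Neg (AtEnd 1))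
     (Seq (Read 1 entry_cells)
     (Seq (Compute (Cell 6) Mod (At (Cell 3)) (Const (Num 2)))
     (Seq (Compute (Cell 3) Div (At (Cell 3)) (Const (Num 2)))
       (If (Equal (At (Cell 6)) (Const (Num 0)))
         (Write 2 entry_operands) (Write 3 entry_operands)))))"

definition radix_pass :: "'c prog" where
  "radix_pass =
     Seq (OpenRead 1 Forward) (Seq (OpenWrite 2 Forward) (Seq (OpenWrite 3 Forward)
     (Seq partition_loop
     (Seq (OpenWrite 1 Forward)
     (Seq (OpenRead 2 Forward) (Seq (copy_loop 2)
     (Seq (OpenRead 3 Forward) (copy_loop 3))))))))"

text \<open>Cell 1 bounds the keys. Its copy in cell 2 is halved along with them, and at zero all
  remaining keys are zero too. Cell 1 itself survives for the second sort.\<close>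

definition radix_sort :: "'c prog" where
  "radix_sort = Seq (Assign (Cell 2) (At (Cell 1)))
     (While (Less (Const (Num 0)) (At (Cell 2)))
       (Seq radix_pass (Compute (Cell 2) Div (At (Cell 2)) (Const (Num 2)))))"

section \<open>Radix sort as a function on lists\<close>

definition split_keys :: "(nat \<times> 'b) list \<Rightarrow> (nat \<times> 'b) list" where
  "split_keys xs = map (map_prod (\<lambda>k. k div 2) id)
     ([x\<leftarrow>xs. even (fst x)] @ [x\<leftarrow>xs. odd (fst x)])"

fun radix :: "nat \<Rightarrow> (nat \<times> 'b) list \<Rightarrow> (nat \<times> 'b) list" where
  "radix L xs = (if L = 0 then xs else radix (L div 2) (split_keys xs))"

text \<open>This is the length of \<open>L\<close> in binary, hence the number of radix
  passes.\<close>

fun halvings :: "nat \<Rightarrow> nat" where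
  "halvings L = (if L = 0 then 0 else Suc (halvings (L div 2)))"

declare radix.simps [simp del] halvings.simps [simp del]

lemma halvings_le_log:
  assumes "0 < L" shows "real (halvings L) \<le> 1 + log 2 (real L)"
  using assms
proof (induction L rule: halvings.induct)
  case (1 L)
  show ?case
  proof (cases "L div 2 = 0")
    case True
    then have "L = 1" using 1 by simp
    then show ?thesis by (simp add: halvings.simps)
  next
    case False
    have "log 2 (real (L div 2)) \<le> log 2 (real L / 2)"
      using False by (subst log_le_cancel_iff) auto
    also have "\<dots> = log 2 (real L) - 1"
      using 1 by (simp add: log_divide)
    finally show ?thesis
      using 1 False by (simp add: halvings.simps[of L])
  qed
qed

lemma concat_map_upt_double:
  "concat (map f [0..<2 * n]) = concat (map (\<lambda>k. f (2 * k) @ f (Suc (2 * k))) [0..<n])"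
  by (induction n) auto

lemma concat_map_upt_extend:
  assumes "K \<le> K'" and "\<And>k. K \<le> k \<Longrightarrow> f k = []"
  shows "concat (map f [0..<K']) = concat (map f [0..<K])"
  using assms(1) by (induction rule: dec_induct) (auto simp: assms(2))

text \<open>Halving merges exactly the keys \<open>2 * k\<close> and \<open>2 * k + 1\<close>; the
  even ones are listed first, and the order among equal keys is kept.\<close>

lemma bucket_split_keys:
  "map snd [x\<leftarrow>split_keys xs. fst x = k] =
     map snd [x\<leftarrow>xs. fst x = 2 * k] @ map snd [x\<leftarrow>xs. fst x = Suc (2 * k)]"
proof -
  have "even m \<and> m div 2 = k \<longleftrightarrow> m = 2 * k" "odd m \<and> m div 2 = k \<longleftrightarrow> m = Suc (2 * k)" for m
    by auto
  then show ?thesis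
    by (simp add: split_keys_def filter_map o_def conj_commute)
qed

text \<open>One pass turns the buckets \<open>2 * k\<close> and \<open>2 * k + 1\<close>, in this
  order, into bucket \<open>k\<close>, so concatenating all buckets gives the same list before and
  after it: the result is the stable sort. Since the keys themselves get lost, only
  \<open>map snd\<close> is described. \<open>K\<close> is any bound beyond \<open>L\<close>, so the
  induction hypothesis applies with the same \<open>K\<close>.\<close>

lemma map_snd_radix:
  assumes "\<And>x. x \<in> set xs \<Longrightarrow> fst x \<le> L" and "L < K"
  shows "map snd (radix L xs) = concat (map (\<lambda>k. map snd [x\<leftarrow>xs. fst x = k]) [0..<K])"
  using assms
proof (induction L xs rule: radix.induct)
  case (1 L xs)
  let ?f = "\<lambda>k. map snd [x\<leftarrow>xs. fst x = k]"
  have empty: "?f k = []" if "Suc L \<le> k" for k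
    using 1(2) that by (fastforce simp: filter_empty_conv)
  show ?case
  proof (cases "L = 0")
    case True
    then have "[x\<leftarrow>xs. fst x = 0] = xs" using 1(2) by (simp add: filter_id_conv)
    then show ?thesis
      using True 1(3) empty by (subst concat_map_upt_extend[of 1]) (auto simp: radix.simps)
  next
    case False
    have "map snd (radix L xs) = map snd (radix (L div 2) (split_keys xs))"
      using False by (simp add: radix.simps[of L])
    also have "\<dots> = concat (map (\<lambda>k. map snd [x\<leftarrow>split_keys xs. fst x = k]) [0..<K])"
      using 1(2,3) by (intro 1(1)[OF False]) (auto simp: split_keys_def intro!: div_le_mono)
    also have "\<dots> = concat (map ?f [0..<2 * K])"
      by (simp add: bucket_split_keys concat_map_upt_double)
    also have "\<dots> = concat (map ?f [0..<K])"
      using 1(3) empty by (intro concat_map_upt_extend) auto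
    finally show ?thesis .
  qed
qed

lemma snd_set_split_keys: "snd ` set (split_keys xs) = snd ` set xs"
  by (force simp: split_keys_def image_iff)

section \<open>Verification of the sorting program\<close>

lemma copy_loop_runs:
  assumes "i \<in> {2, 3}" and "mode (streams s i) = Reading (map enc xs)"
    and "mode (streams s 1) = Writing Forward"
    and "\<And>k x c. (k, x, c) \<in> set xs \<Longrightarrow> k \<le> B \<and> x \<le> B"
    and "calm c n s" and "c \<le> 30"
  shows "runs 3 B (copy_loop i) s (\<lambda>s'. calm (Suc c) n s' \<and>
     mode (streams s' 1) = Writing Forward \<and>
     content (streams s' 1) = content (streams s 1) @ map enc xs \<and>
     (\<forall>j. j \<noteq> 1 \<longrightarrow> content (streams s' j) = content (streams s j)) \<and>
     (\<forall>x. x < 3 \<longrightarrow> mem s' x = mem s x))"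
  unfolding copy_loop_def
\<comment> \<open>The copied stream may be empty, so no access is sure to reset the clock: its bound
  stays \<open>c\<close>, and the failing test adds one. The other contents are tracked because
  stream 3 must survive the copying of stream 2.\<close>
proof (rule runs_While_list[where xs = xs and I = "\<lambda>zs s'. calm c n s' \<and> set zs \<subseteq> set xs \<and>
     mode (streams s' i) = Reading (map enc zs) \<and> mode (streams s' 1) = Writing Forward \<and>
     content (streams s' 1) @ map enc zs = content (streams s 1) @ map enc xs \<and>
     (\<forall>j. j \<noteq> 1 \<longrightarrow> content (streams s' j) = content (streams s j)) \<and>
     (\<forall>x. x < 3 \<longrightarrow> mem s' x = mem s x)"])
  show "calm c n s \<and> set xs \<subseteq> set xs \<and>
     mode (streams s i) = Reading (map enc xs) \<and> mode (streams s 1) = Writing Forward \<and>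
     content (streams s 1) @ map enc xs = content (streams s 1) @ map enc xs \<and>
     (\<forall>j. j \<noteq> 1 \<longrightarrow> content (streams s j) = content (streams s j)) \<and>
     (\<forall>x. x < 3 \<longrightarrow> mem s x = mem s x)"
    using assms by simp
qed (use assms(1,4,6) in \<open>auto simp: runs_simps state_simps calm_def\<close>)

text \<open>A nonempty stream guarantees an access that resets the clock; this prevents the clock
  from accumulating over successive radix passes. \<open>0 < B\<close> allows the parity to be
  stored.\<close>

lemma partition_loop_runs:
  assumes "streams s 1 = \<lparr>content = ys, mode = Reading (map enc xs)\<rparr>"
    and "streams s 2 = \<lparr>content = [], mode = Writing Forward\<rparr>"
    and "streams s 3 = \<lparr>content = [], mode = Writing Forward\<rparr>"
    and "\<And>k x c. (k, x, c) \<in> set xs \<Longrightarrow> k \<le> B \<and> x \<le> B"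
    and "xs \<noteq> []" and "0 < B" and "calm c n s" and "c \<le> 30"
  shows "runs 3 B partition_loop s (\<lambda>s'. calm 1 n s' \<and>
     content (streams s' 2) @ content (streams s' 3) = map enc (split_keys xs) \<and>
     (\<forall>x. x < 3 \<longrightarrow> mem s' x = mem s x))"
proof -
  let ?h = "map_prod (\<lambda>k. k div 2) id"
  let ?P = "\<lambda>Q zs. map (enc \<circ> ?h) [x\<leftarrow>zs. Q (fst x)]"
  \<comment> \<open>The bound \<open>c\<close> is in force only before the first iteration, since
    every iteration ends with a write and leaves the clock at 0.\<close>
  define I where "I = (\<lambda>zs s'. calm (if length zs = length xs then c else 0) n s' \<and>
     set zs \<subseteq> set xs \<and> length zs \<le> length xs \<and>
     mode (streams s' 1) = Reading (map enc zs) \<and>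
     mode (streams s' 2) = Writing Forward \<and> mode (streams s' 3) = Writing Forward \<and>
     content (streams s' 2) @ ?P even zs = ?P even xs \<and>
     content (streams s' 3) @ ?P odd zs = ?P odd xs \<and>
     (\<forall>x. x < 3 \<longrightarrow> mem s' x = mem s x))"
  have "I xs s" using assms by (simp add: I_def)
  then show ?thesis
    unfolding partition_loop_def
  proof (rule runs_While_list)
    fix x zs s' assume I: "I (x # zs) s'"
    obtain k y c' where x: "x = (k, y, c')" using prod_cases3 by blast
    have kB: "k \<le> B" "y \<le> B" using I assms(4) by (auto simp: I_def x)
    then have "k mod 2 \<le> B" "k div 2 \<le> B" "Suc 0 \<le> B" using assms(6) by auto
    then show "holds s' (Neg (AtEnd 1)) \<and> runs 3 B (Seq (Read 1 entry_cells)
       (Seq (Compute (Cell 6) Mod (At (Cell 3)) (Const (Num 2)))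
       (Seq (Compute (Cell 3) Div (At (Cell 3)) (Const (Num 2)))
         (If (Equal (At (Cell 6)) (Const (Num 0)))
           (Write 2 entry_operands) (Write 3 entry_operands))))) (tick s') (I zs)"
      using I kB assms(8)
      by (cases "even k")
        (simp_all add: x I_def runs_simps state_simps calm_def odd_iff_mod_2_eq_one
          even_iff_mod_2_eq_zero split: if_splits)
  next
    fix s' assume "I [] s'"
    then show "\<not> holds s' (Neg (AtEnd 1)) \<and> calm 1 n (tick s') \<and>
       content (streams (tick s') 2) @ content (streams (tick s') 3) = map enc (split_keys xs) \<and>
       (\<forall>x. x < 3 \<longrightarrow> mem (tick s') x = mem s x)"
      using assms(5) by (auto simp: I_def calm_def tick_def split_keys_def)
  qed
qed

text \<open>Three passes distribute and three concatenate. The final clock does not depend on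
  \<open>c\<close>: the partition leaves at most 1, and three openings and two failing loop tests
  follow.\<close>

lemma radix_pass_runs:
  assumes "content (streams s 1) = map enc xs" and "xs \<noteq> []" and "0 < B"
    and bounds: "\<And>k x c. (k, x, c) \<in> set xs \<Longrightarrow> k \<le> B \<and> x \<le> B"
    and "calm c n s" and "c \<le> 20"
  shows "runs 3 B radix_pass s (\<lambda>s'. calm 6 (n + 6) s' \<and>
     content (streams s' 1) = map enc (split_keys xs) \<and>
     (\<forall>x. x < 3 \<longrightarrow> mem s' x = mem s x))"
proof -
  have split: "k \<le> B \<and> x \<le> B" if "(k, x, c) \<in> set (split_keys xs)" for k x c
  proof -
    obtain k' where "(k', x, c) \<in> set xs" "k = k' div 2"
      using \<open>(k, x, c) \<in> set (split_keys xs)\<close> by (auto simp: split_keys_def)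
    then show ?thesis using bounds[of k' x c] by (auto intro: le_trans[OF div_le_dividend])
  qed
  let ?s1 = "set_stream 3 \<lparr>content = [], mode = Writing Forward\<rparr> (new_pass (tick
    (set_stream 2 \<lparr>content = [], mode = Writing Forward\<rparr> (new_pass (tick
    (set_stream 1 \<lparr>content = map enc xs, mode = Reading (map enc xs)\<rparr> (new_pass (tick s))))))))"
  have partition: "runs 3 B partition_loop ?s1 (\<lambda>s'. calm 1 (n + 3) s' \<and>
     content (streams s' 2) @ content (streams s' 3) = map enc (split_keys xs) \<and>
     (\<forall>x. x < 3 \<longrightarrow> mem s' x = mem ?s1 x))"
    \<comment> \<open>23 is the initial bound 20 plus the three opening commands.\<close>
    by (rule partition_loop_runs[where c = 23 and xs = xs])
      (use assms in \<open>auto simp: state_simps calm_def\<close>)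
  have copies: "runs 3 B
     (Seq (OpenWrite 1 Forward)
     (Seq (OpenRead 2 Forward) (Seq (copy_loop 2)
     (Seq (OpenRead 3 Forward) (copy_loop 3))))) s2 (\<lambda>s'. calm 6 (n + 6) s' \<and>
     content (streams s' 1) = map enc (split_keys xs) \<and> (\<forall>x. x < 3 \<longrightarrow> mem s' x = mem s x))"
    if s2: "calm 1 (n + 3) s2" "\<forall>x. x < 3 \<longrightarrow> mem s2 x = mem s x"
      "content (streams s2 2) @ content (streams s2 3) = map enc (split_keys xs)" for s2
  proof -
    \<comment> \<open>The border between streams 2 and 3 cuts the list in two; copying the pieces
      one after the other restores it.\<close>
    obtain us vs where uv: "split_keys xs = us @ vs" "content (streams s2 2) = map enc us"
      "content (streams s2 3) = map enc vs"
      using s2(3) by (auto simp: append_eq_map_conv)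
    let ?s3 = "set_stream 2 \<lparr>content = map enc us, mode = Reading (map enc us)\<rparr> (new_pass (tick
      (set_stream 1 \<lparr>content = [], mode = Writing Forward\<rparr> (new_pass (tick s2)))))"
    let ?open3 = "\<lambda>s. set_stream 3 \<lparr>content = map enc vs, mode = Reading (map enc vs)\<rparr>
      (new_pass (tick s))"
    have copy2: "runs 3 B (copy_loop 2) ?s3 (\<lambda>s'. calm (Suc 3) (n + 5) s' \<and>
       mode (streams s' 1) = Writing Forward \<and>
       content (streams s' 1) = content (streams ?s3 1) @ map enc us \<and>
       (\<forall>j. j \<noteq> 1 \<longrightarrow> content (streams s' j) = content (streams ?s3 j)) \<and>
       (\<forall>x. x < 3 \<longrightarrow> mem s' x = mem ?s3 x))"
      by (rule copy_loop_runs) (use s2 split in \<open>auto simp: state_simps calm_def uv\<close>)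
    have copy3: "runs 3 B (copy_loop 3) (?open3 s4) (\<lambda>s'. calm (Suc 5) (n + 6) s' \<and>
       mode (streams s' 1) = Writing Forward \<and>
       content (streams s' 1) = content (streams (?open3 s4) 1) @ map enc vs \<and>
       (\<forall>j. j \<noteq> 1 \<longrightarrow> content (streams s' j) = content (streams (?open3 s4) j)) \<and>
       (\<forall>x. x < 3 \<longrightarrow> mem s' x = mem (?open3 s4) x))"
      if "calm 4 (n + 5) s4" "mode (streams s4 1) = Writing Forward" for s4
      by (rule copy_loop_runs) (use that split in \<open>auto simp: state_simps calm_def uv\<close>)
    have "runs 3 B (Seq (OpenRead 3 Forward) (copy_loop 3)) s4 (\<lambda>s'. calm 6 (n + 6) s' \<and>
       content (streams s' 1) = map enc (split_keys xs) \<and> (\<forall>x. x < 3 \<longrightarrow> mem s' x = mem s x))"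
      if "calm (Suc 3) (n + 5) s4 \<and> mode (streams s4 1) = Writing Forward \<and>
       content (streams s4 1) = content (streams ?s3 1) @ map enc us \<and>
       (\<forall>j. j \<noteq> 1 \<longrightarrow> content (streams s4 j) = content (streams ?s3 j)) \<and>
       (\<forall>x. x < 3 \<longrightarrow> mem s4 x = mem ?s3 x)" for s4
    proof -
      have "content (streams s4 3) = map enc vs"
        using that by (simp add: state_simps uv)
      then have "runs 3 B (Seq (OpenRead 3 Forward) (copy_loop 3)) s4 R
        \<longleftrightarrow> runs 3 B (copy_loop 3) (?open3 s4) R" for R
        by (simp add: runs_Seq runs_OpenRead in_direction_def)
      moreover have "runs 3 B (copy_loop 3) (?open3 s4) (\<lambda>s'. calm 6 (n + 6) s' \<and>
         content (streams s' 1) = map enc (split_keys xs) \<and>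
         (\<forall>x. x < 3 \<longrightarrow> mem s' x = mem s x))"
        by (rule runs_mono[OF copy3]) (use that s2 in \<open>auto simp: state_simps uv(1)\<close>)
      ultimately show ?thesis by blast
    qed
    from runs_mono[OF copy2 this] show ?thesis
      by (simp add: runs_Seq runs_OpenRead runs_OpenWrite in_direction_def uv(2)
          set_stream_def new_pass_def tick_def)
  qed
  have "runs 3 B radix_pass s R \<longleftrightarrow> runs 3 B partition_loop ?s1 (\<lambda>s'. runs 3 B
     (Seq (OpenWrite 1 Forward)
     (Seq (OpenRead 2 Forward) (Seq (copy_loop 2)
     (Seq (OpenRead 3 Forward) (copy_loop 3))))) s' R)" for R
    unfolding radix_pass_def runs_Seq[of _ _ "OpenRead 1 Forward"]
      runs_Seq[of _ _ "OpenWrite 2 Forward"] runs_Seq[of _ _ "OpenWrite 3 Forward"]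
      runs_Seq[of _ _ partition_loop] runs_OpenRead[of _ _ 1] runs_OpenWrite[of _ _ 2]
      runs_OpenWrite[of _ _ 3]
    by (simp add: in_direction_def assms(1)[simplified])
  then show ?thesis
    by (simp only:)
      (rule runs_mono[OF partition copies]; simp add: set_stream_def new_pass_def tick_def)
qed

text \<open>A pass leaves the clock at 6 or less and halving cell 2 adds one, so a bound
  \<open>c\<close> of at least 7 holds again at each loop test. The failing test accounts for
  \<open>Suc c\<close>.\<close>

lemma radix_loop_runs:
  assumes "content (streams s 1) = map enc xs" and "xs \<noteq> []" and "0 < B" and "L \<le> B"
    and "\<And>k x c. (k, x, c) \<in> set xs \<Longrightarrow> k \<le> B \<and> x \<le> B"
    and "calm c n s" and "7 \<le> c" and "c \<le> 19" and "mem s 2 = Num L" and "mem s 1 = Num m"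
  shows "runs 3 B (While (Less (Const (Num 0)) (At (Cell 2)))
       (Seq radix_pass (Compute (Cell 2) Div (At (Cell 2)) (Const (Num 2))))) s
     (\<lambda>s'. calm (Suc c) (n + 6 * halvings L) s' \<and> content (streams s' 1) = map enc (radix L xs) \<and>
       mem s' 1 = Num m)"
  using assms
proof (induction L xs arbitrary: s n rule: radix.induct)
  case (1 L xs)
  show ?case
  proof (cases "L = 0")
    case True
    show ?thesis
      by (rule runs_While_False)
        (use 1 True in \<open>auto simp: radix.simps halvings.simps calm_def tick_def\<close>)
  next
    case False
    have split: "k \<le> B \<and> x \<le> B" if "(k, x, c) \<in> set (split_keys xs)" for k x c
    proof -
      obtain k' where "(k', x, c) \<in> set xs" "k = k' div 2"
        using \<open>(k, x, c) \<in> set (split_keys xs)\<close> by (auto simp: split_keys_def)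
      then show ?thesis using 1(6)[of k' x c] by (auto intro: le_trans[OF div_le_dividend])
    qed
    have ne: "split_keys xs \<noteq> []"
      using 1(3) snd_set_split_keys[of xs] by auto
    have "L div 2 \<le> B" using 1(5) by simp
    note IH = 1(1)[OF False _ ne 1(4) this split]
    show ?thesis
    proof (rule runs_While_True)
      show "holds s (Less (Const (Num 0)) (At (Cell 2)))" using 1 False by simp
    next
      have "runs 3 B radix_pass (tick s) (\<lambda>s'. calm 6 (n + 6) s' \<and>
         content (streams s' 1) = map enc (split_keys xs) \<and>
         (\<forall>x. x < 3 \<longrightarrow> mem s' x = mem (tick s) x))"
        by (rule radix_pass_runs[where c = "Suc c"]) (use 1 in \<open>auto simp: calm_def tick_def\<close>)
      then show "runs 3 B
         (Seq radix_pass (Compute (Cell 2) Div (At (Cell 2)) (Const (Num 2)))) (tick s)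
         (\<lambda>s'. runs 3 B (While (Less (Const (Num 0)) (At (Cell 2)))
           (Seq radix_pass (Compute (Cell 2) Div (At (Cell 2)) (Const (Num 2))))) s'
           (\<lambda>s'. calm (Suc c) (n + 6 * halvings L) s' \<and>
             content (streams s' 1) = map enc (radix L xs) \<and> mem s' 1 = Num m))"
        unfolding runs_Seq
      proof (rule runs_mono)
        fix s' assume s': "calm 6 (n + 6) s' \<and>
           content (streams s' 1) = map enc (split_keys xs) \<and>
           (\<forall>x. x < 3 \<longrightarrow> mem s' x = mem (tick s) x)"
        have eqs: "n + 6 * halvings L = n + 6 + 6 * halvings (L div 2)"
          "radix L xs = radix (L div 2) (split_keys xs)"
          using False by (simp_all add: halvings.simps[of L] radix.simps[of L])
        have "runs 3 B (While (Less (Const (Num 0)) (At (Cell 2)))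
             (Seq radix_pass (Compute (Cell 2) Div (At (Cell 2)) (Const (Num 2)))))
             (put (Cell 2) (Num (L div 2)) (tick s'))
             (\<lambda>s'. calm (Suc c) (n + 6 * halvings L) s' \<and>
               content (streams s' 1) = map enc (radix L xs) \<and> mem s' 1 = Num m)"
          unfolding eqs by (rule IH) (use s' 1 in \<open>auto simp: state_simps calm_def\<close>)
        moreover have "mem s' 2 = Num L" "L div 2 \<le> B" using s' 1 by (auto simp: tick_def)
        ultimately show "runs 3 B (Compute (Cell 2) Div (At (Cell 2)) (Const (Num 2))) s'
           (\<lambda>s'. runs 3 B (While (Less (Const (Num 0)) (At (Cell 2)))
             (Seq radix_pass (Compute (Cell 2) Div (At (Cell 2)) (Const (Num 2))))) s'
             (\<lambda>s'. calm (Suc c) (n + 6 * halvings L) s' \<and>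
               content (streams s' 1) = map enc (radix L xs) \<and> mem s' 1 = Num m))"
          by (simp add: runs_Compute)
      qed
    qed
  qed
qed

lemma radix_sort_runs:
  assumes "content (streams s 1) = map enc xs" and "xs \<noteq> []" and "0 < B" and "L \<le> B"
    and "\<And>k x c. (k, x, c) \<in> set xs \<Longrightarrow> k \<le> B \<and> x \<le> B"
    and "calm c n s" and "6 \<le> c" and "c \<le> 18" and "mem s 1 = Num L"
  shows "runs 3 B radix_sort s (\<lambda>s'. calm (Suc (Suc c)) (n + 6 * halvings L) s' \<and>
     content (streams s' 1) = map enc (radix L xs) \<and> mem s' 1 = Num L)"
  unfolding radix_sort_def runs_Seq[of _ _ "Assign _ _"] runs_Assign
proof
  show "fits B (val s (At (Cell 1)))" using assms by simp
qed (rule radix_loop_runs[where c = "Suc c"], use assms in \<open>auto simp: calm_def state_simps\<close>)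

section \<open>Tags with their depth in the encoding\<close>

text \<open>The intended output with depths in the encoding. First child and next sibling are both
  children there, so both recursive calls go one level deeper.\<close>

fun fcns_tags :: "nat \<Rightarrow> 'a utree list \<Rightarrow> (nat \<times> 'a tag) list" where
  "fcns_tags d [] = []"
| "fcns_tags d (UNode a ts # us) =
     (d, Opening a) # fcns_tags (Suc d) ts @ (d, Closing a) # fcns_tags (Suc d) us"

lemma map_snd_fcns_tags: "map snd (fcns_tags d ts) = concat (map xml ts)"
  by (induction d ts rule: fcns_tags.induct) auto

fun blank :: "'a tag \<Rightarrow> 'a tag" where
  "blank (Opening a) = Opening a"
| "blank (Closing a) = Closing undefined"

text \<open>The flag tells whether the last letter was the closing tag of a right child; then the place
  of the closing tag of its parent has already been passed. The position of an emitted tag is its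
  index in the list.\<close>

fun emit :: "bool \<Rightarrow> nat \<Rightarrow> ('a \<times> side) tag list \<Rightarrow> (nat \<times> 'a tag) list" where
  "emit r d [] = []"
| "emit r d (Opening (a, LeftChild) # cs) = (d, Opening a) # emit False (Suc d) cs"
| "emit r d (Opening (a, RightChild) # cs) =
     (d - 1, Closing undefined) # (d, Opening a) # emit False (Suc d) cs"
| "emit r d (Closing (a, e) # cs) =
     (if r then [] else [(d - 1, Closing undefined)]) @ emit (e = RightChild) (d - 1) cs"

text \<open>The closing tag of a node is emitted when its right child opens or, without a right
  child, when the node itself closes in the encoding. So a forest on the right side first yields the
  closing tag of its parent, at depth \<open>d - 1\<close>, and leaves the flag set to keep the
  parent from emitting again. The rest \<open>cs\<close> is arbitrary so that in the induction other
  letters may follow a subtree.\<close>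

lemma emit_fcns_forest:
  "emit r d (xml_bin (fcns_forest e ts) @ cs) =
     (if ts = [] then emit r d cs
      else (if e = RightChild then [(d - 1, Closing undefined)] else []) @
        map (map_prod id blank) (fcns_tags d ts) @ emit (e = RightChild) d cs)"
proof (induction e ts arbitrary: r d cs rule: fcns_forest.induct)
  case (2 e a ts us)
  show ?case by (cases e) (auto simp: 2)
qed simp

lemma emit_fcns:
  "emit False 0 (xml_bin (fcns t)) = map (map_prod id blank) (fcns_tags 0 [t])"
  using emit_fcns_forest[of False 0 LeftChild "[t]" "[]"] by (simp add: fcns_def)

lemma length_xml: "length (xml t) = 2 * nodes t"
  by (induction t) (simp add: length_concat o_def sum_list_const_mult cong: map_cong)

lemma length_xml_bin: "length (xml_bin t) = 2 * size t"
  by (induction t) auto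

lemma size_fcns_forest: "size (fcns_forest d ts) = sum_list (map nodes ts)"
  by (induction d ts rule: fcns_forest.induct) auto

section \<open>Restoring the labels of closing tags\<close>

fun fill :: "'a \<Rightarrow> ('b \<times> 'a tag) list \<Rightarrow> ('b \<times> 'a tag) list" where
  "fill b [] = []"
| "fill b ((x, Opening a) # xs) = (x, Opening a) # fill a xs"
| "fill b ((x, Closing a) # xs) = (x, Closing b) # fill b xs"

inductive paired :: "('b \<times> 'a tag) list \<Rightarrow> bool" where
  Nil: "paired []"
| Cons: "paired xs \<Longrightarrow> paired ((x, Opening a) # (y, Closing a) # xs)"

lemma paired_append: "paired xs \<Longrightarrow> paired ys \<Longrightarrow> paired (xs @ ys)"
  by (induction rule: paired.induct) (auto intro: paired.intros)

lemma paired_concat: "(\<And>xs. xs \<in> set xss \<Longrightarrow> paired xs) \<Longrightarrow> paired (concat xss)"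
  by (induction xss) (auto intro: paired.intros paired_append)

text \<open>Each closing tag directly follows its own opening tag, whose label \<open>fill\<close>
  still holds; the start value \<open>b\<close> is overwritten by the first opening tag.\<close>

lemma fill_paired: "paired xs \<Longrightarrow> fill b (map (map_prod id blank) xs) = xs"
  by (induction arbitrary: b rule: paired.induct) auto

lemma fcns_tags_ge: "p \<in> set (fcns_tags d ts) \<Longrightarrow> d \<le> fst p"
  by (induction d ts rule: fcns_tags.induct) auto

text \<open>The offset \<open>n\<close> lets positions continue across an append.\<close>

definition bucket :: "nat \<Rightarrow> nat \<Rightarrow> (nat \<times> 'a tag) list \<Rightarrow> (nat \<times> 'a tag) list" where
  "bucket k n xs = map (\<lambda>(x, d, c). (x, c)) [(x, d, c)\<leftarrow>enumerate n xs. d = k]"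

lemma bucket_simps [simp]:
  "bucket k n [] = []"
  "bucket k n (p # xs) = (if fst p = k then [(n, snd p)] else []) @ bucket k (Suc n) xs"
  "bucket k n (xs @ ys) = bucket k n xs @ bucket k (n + length xs) ys"
  by (auto simp: bucket_def enumerate_append_eq split: prod.splits)

lemma bucket_eq_Nil: "(\<And>p. p \<in> set xs \<Longrightarrow> fst p \<noteq> k) \<Longrightarrow> bucket k n xs = []"
  by (induction xs arbitrary: n) auto

text \<open>In a forest starting at depth \<open>d\<close> only the first node has depth
  \<open>d\<close>: its children and its later siblings lie deeper in the encoding. So bucket
  \<open>d\<close> is a single pair, and every other bucket is joined from those of the two
  parts.\<close>

lemma paired_bucket: "paired (bucket k n (fcns_tags d ts))"
proof (induction d ts arbitrary: n rule: fcns_tags.induct)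
  case (2 d a ts us)
  show ?case
  proof (cases "k = d")
    case True
    have "bucket d m (fcns_tags (Suc d) vs) = []" for m and vs :: "'a utree list"
      using fcns_tags_ge[of _ "Suc d" vs] by (intro bucket_eq_Nil) fastforce
    then show ?thesis using True by (auto intro: paired.intros)
  next
    case False
    then show ?thesis using 2 by (auto intro: paired_append)
  qed
qed (auto intro: paired.intros)

section \<open>Buckets and permutations\<close>

lemma mset_concat_buckets:
  assumes "\<And>x. x \<in> set xs \<Longrightarrow> f x < (K :: nat)"
  shows "mset (concat (map (\<lambda>k. [x\<leftarrow>xs. f x = k]) [0..<K])) = mset xs"
  using assms
proof (induction xs)
  case (Cons x xs)
  \<comment> \<open>For any list \<open>ks\<close> of bucket indices, \<open>x\<close> is added once
    per occurrence of \<open>f x\<close>; in \<open>[0..<K]\<close> there is exactly one.\<close>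
  have "mset (concat (map (\<lambda>k. [y\<leftarrow>x # xs. f y = k]) ks)) =
    mset (concat (map (\<lambda>k. [y\<leftarrow>xs. f y = k]) ks)) + replicate_mset (count_list ks (f x)) x" for ks
    by (induction ks) auto
  moreover have "count_list [0..<K] (f x) = 1"
    using Cons.prems by (simp flip: count_mset add: distinct_count_atmost_1)
  ultimately show ?case using Cons by simp
qed (simp add: concat_eq_Nil_conv)

lemma filter_distinct_fst:
  assumes "distinct (map fst xs)" and "(k, c) \<in> set xs"
  shows "[x\<leftarrow>xs. fst x = k] = [(k, c)]"
  using assms
proof (induction xs)
  case (Cons x xs)
  show ?case
  proof (cases "fst x = k")
    case True
    then have "k \<notin> fst ` set xs" using Cons.prems by auto
    then have "(k, c) \<notin> set xs" "[x\<leftarrow>xs. fst x = k] = []"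
      by (force, auto simp: filter_empty_conv)
    then show ?thesis using True Cons.prems by auto
  next
    case False
    then show ?thesis using Cons by auto
  qed
qed simp

text \<open>Positions are distinct, so a bucket holds one entry, or none beyond the end. Sorting by
  position therefore undoes any permutation.\<close>

lemma concat_buckets_permuted_enumerate:
  assumes "mset xs = mset (enumerate 0 cs)" and "length cs \<le> K"
  shows "concat (map (\<lambda>k. [x\<leftarrow>xs. fst x = k]) [0..<K]) = enumerate 0 cs"
proof -
  have set: "set xs = set (enumerate 0 cs)" using assms(1) by (rule mset_eq_setD)
  have "distinct (map fst xs)"
    using assms(1) by (metis distinct_upt map_fst_enumerate mset_eq_imp_distinct_iff mset_map)
  moreover have "(k, cs ! k) \<in> set xs" if "k < length cs" for k
    using set that by (simp add: in_set_enumerate_eq)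
  ultimately have "map (\<lambda>k. [x\<leftarrow>xs. fst x = k]) [0..<length cs] =
      map (\<lambda>k. [(k, cs ! k)]) [0..<length cs]"
    by (intro map_cong) (auto simp: filter_distinct_fst)
  moreover have "enumerate 0 cs = map (\<lambda>k. (k, cs ! k)) [0..<length cs]"
    by (rule nth_equalityI) (auto simp: nth_enumerate_eq)
  moreover have "concat (map (\<lambda>k. [x\<leftarrow>xs. fst x = k]) [0..<K]) =
      concat (map (\<lambda>k. [x\<leftarrow>xs. fst x = k]) [0..<length cs])"
    using assms(2)
    by (rule concat_map_upt_extend) (auto simp: filter_empty_conv set in_set_enumerate_eq)
  ultimately show ?thesis
    by (simp only: concat_map_singleton)
qed

section \<open>The decoding program\<close>

definition entries :: "nat \<Rightarrow> (nat \<times> 'a tag) list \<Rightarrow> 'a letter entry list" where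
  "entries n es = map (\<lambda>(x, d, c). (d, x, Inr c)) (enumerate n es)"

lemma entries_simps [simp]:
  "entries n [] = []"
  "entries n (e # es) = (fst e, n, Inr (snd e)) # entries (Suc n) es"
  by (auto simp: entries_def split: prod.splits)

abbreviation blank_letter :: "'a letter" where
  "blank_letter \<equiv> Inr (Closing undefined)"

fun plain :: "'a letter \<Rightarrow> 'a letter" where
  "plain (Inl (Opening (a, e))) = Inr (Opening a)"
| "plain c = c"

fun closing :: "'a letter \<Rightarrow> 'a letter" where
  "closing (Inr (Opening a)) = Inr (Closing a)"
| "closing c = c"

text \<open>Cell 0 holds the depth, cell 1 the position of the next emitted tag, cell 2 the flag of
  \<open>emit\<close>. The final position bounds all keys, which is what \<open>radix_sort\<close> expects in cell 1.\<close>

definition increment :: "nat \<Rightarrow> 'c prog" where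
  "increment i = Compute (Cell i) Add (At (Cell i)) (Const (Num 1))"

text \<open>A closing tag decrements cell 0 before the write, so that it holds the depth of the node
  being closed; an opening right child computes the depth of its parent in cell 4.\<close>

definition emit_step :: "'a letter prog" where
  "emit_step =
     Seq (Read 0 [Cell 3])
     (If (IsIn (At (Cell 3)) (range (Inl \<circ> Opening)))
       (Seq
         (If (IsIn (At (Cell 3)) (range (\<lambda>a. Inl (Opening (a, RightChild)))))
           (Seq (Compute (Cell 4) Sub (At (Cell 0)) (Const (Num 1)))
           (Seq (Write 1 [At (Cell 4), At (Cell 1), Const (Sym blank_letter)]) (increment 1)))
           Skip)
       (Seq (Translate (Cell 3) plain (At (Cell 3)))
       (Seq (Write 1 [At (Cell 0), At (Cell 1), At (Cell 3)])
       (Seq (increment 1) (Seq (increment 0) (Assign (Cell 2) (Const (Num 0))))))))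
       (Seq (Compute (Cell 0) Sub (At (Cell 0)) (Const (Num 1)))
       (Seq
         (If (Equal (At (Cell 2)) (Const (Num 0)))
           (Seq (Write 1 [At (Cell 0), At (Cell 1), Const (Sym blank_letter)]) (increment 1))
           Skip)
         (If (IsIn (At (Cell 3)) (range (\<lambda>a. Inl (Closing (a, RightChild)))))
           (Assign (Cell 2) (Const (Num 1))) (Assign (Cell 2) (Const (Num 0)))))))"

definition emit_loop :: "'a letter prog" where
  "emit_loop = While (Neg (AtEnd 0)) emit_step"

text \<open>The cells written so far, followed by what \<open>emit\<close> will still produce, stay
  constant. A letter raises the depth by at most one, so \<open>d + length cs\<close> never grows
  and keeps the depth within \<open>B\<close>. The clock reaches 6 on a closing tag for which
  nothing is written.\<close>

definition emitting :: "nat \<Rightarrow> nat \<Rightarrow> (nat \<times> 'a tag) list \<Rightarrow> ('a \<times> side) tag list \<Rightarrow>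
    'a letter state \<Rightarrow> bool" where
  "emitting B n es cs s \<longleftrightarrow> calm 6 n s \<and>
     mode (streams s 0) = Reading (map (\<lambda>c. [Sym (Inl c)]) cs) \<and>
     mode (streams s 1) = Writing Forward \<and>
     (\<exists>r d x. mem s 2 = Num (of_bool r) \<and> mem s 0 = Num d \<and> mem s 1 = Num x \<and>
       d + length cs \<le> B \<and> x + length (emit r d cs) = length es \<and>
       content (streams s 1) @ map enc (entries x (emit r d cs)) = map enc (entries 0 es))"

lemma emit_step_runs:
  assumes "emitting B n es (c # cs) s" and "length es \<le> B"
  shows "runs 3 B emit_step (tick s) (emitting B n es cs)"
proof -
  from assms(1) obtain r d x where s: "mem s 2 = Num (of_bool r)" "mem s 0 = Num d"
    "mem s 1 = Num x" "d + length (c # cs) \<le> B" "x + length (emit r d (c # cs)) = length es"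
    "content (streams s 1) @ map enc (entries x (emit r d (c # cs))) = map enc (entries 0 es)"
    "calm 6 n s" "mode (streams s 0) = Reading (map (\<lambda>c. [Sym (Inl c)]) (c # cs))"
    "mode (streams s 1) = Writing Forward"
    unfolding emitting_def by blast
  have B: "1 \<le> B" "d - 1 \<le> B" using s(4) by simp_all
  obtain a e where "c = Opening (a, e) \<or> c = Closing (a, e)"
    by (metis surj_pair tag.exhaust)
  then consider "c = Opening (a, LeftChild)" | "c = Opening (a, RightChild)"
    | "c = Closing (a, LeftChild)" | "c = Closing (a, RightChild)"
    by (cases e) auto
  then show ?thesis
  proof cases
    case 1
    show ?thesis
      using s B(1) assms(2) unfolding emit_step_def increment_def emitting_def 1
      by (simp add: runs_simps state_simps calm_def image_iff) (rule exI[of _ False], simp)?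
  next
    case 2
    show ?thesis
      using s B assms(2) unfolding emit_step_def increment_def emitting_def 2
      by (simp add: runs_simps state_simps calm_def image_iff) (rule exI[of _ False], simp)?
  next
    case 3
    show ?thesis
      unfolding emit_step_def increment_def emitting_def 3
      by (cases r; insert s B(1) assms(2); simp add: runs_simps state_simps calm_def image_iff 3;
          intro conjI exI[of _ False]; simp)
  next
    case 4
    show ?thesis
      unfolding emit_step_def increment_def emitting_def 4
      \<comment> \<open>The witness is the new flag, which only the closing tag of a right child
        sets.\<close>
      by (cases r; insert s B(1) assms(2); simp add: runs_simps state_simps calm_def image_iff 4;
          intro conjI exI[of _ True]; simp)
  qed
qed

lemma emit_loop_runs:
  assumes "emitting B n es cs s" and "length es \<le> B"
  shows "runs 3 B emit_loop s (\<lambda>s'. calm 7 n s' \<and> mem s' 1 = Num (length es) \<and>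
     content (streams s' 1) = map enc (entries 0 es))"
  unfolding emit_loop_def
proof (rule runs_While_list[where I = "emitting B n es", OF assms(1)])
  fix c cs s assume "emitting B n es (c # cs) s"
  from emit_step_runs[OF this assms(2)] this
  show "holds s (Neg (AtEnd 0)) \<and> runs 3 B emit_step (tick s) (emitting B n es cs)"
    by (simp add: emitting_def)
next
  fix s assume "emitting B n es [] s"
  then show "\<not> holds s (Neg (AtEnd 0)) \<and> calm 7 n (tick s) \<and> mem (tick s) 1 = Num (length es) \<and>
     content (streams (tick s) 1) = map enc (entries 0 es)"
    by (auto simp: emitting_def calm_def tick_def)
qed


section \<open>The pass that copies labels to closing tags\<close>

definition fill_step :: "'a letter prog" where
  "fill_step =
     Seq (Read 1 entry_cells)
     (Seq (If (IsIn (At (Cell 5)) (range (Inr \<circ> Opening)))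
       (Assign (Cell 6) (At (Cell 5)))
       (Translate (Cell 5) closing (At (Cell 6))))
       (Write 2 [At (Cell 4), At (Cell 4), At (Cell 5)]))"

text \<open>Cell 6 was used for parities by the sort and must hold an opening tag before the loop.
  The result is copied back because \<open>radix_sort\<close> expects its input on stream 1.\<close>

definition fill_pass :: "'a letter prog" where
  "fill_pass =
     Seq (OpenRead 1 Forward) (Seq (OpenWrite 2 Forward)
     (Seq (Assign (Cell 6) (Const (Sym (Inr (Opening undefined)))))
     (Seq (While (Neg (AtEnd 1)) fill_step)
     (Seq (OpenWrite 1 Forward) (Seq (OpenRead 2 Forward) (copy_loop 2))))))"

text \<open>The position replaces the spent depth as the key.\<close>

definition positions :: "(nat \<times> 'a tag) list \<Rightarrow> 'a letter entry list" where
  "positions zs = map (\<lambda>(x, c). (x, x, Inr c)) zs"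

text \<open>The cells \<open>ys\<close> come from a sort and are known only up to their keys;
  \<open>zs\<close> is what is known of them. The clock bound is the 10 of
  \<open>fill_pass_runs\<close> plus its first three commands.\<close>

definition filling :: "nat \<Rightarrow> nat \<Rightarrow> nat \<Rightarrow> (nat \<times> 'a tag) list \<Rightarrow> 'a letter entry list \<Rightarrow>
    'a letter state \<Rightarrow> bool" where
  "filling B n L ws ys s \<longleftrightarrow> calm 13 n s \<and> mem s 1 = Num L \<and>
     mode (streams s 1) = Reading (map enc ys) \<and> mode (streams s 2) = Writing Forward \<and>
     (\<exists>b zs. map snd ys = map (map_prod id Inr) zs \<and> (\<forall>z \<in> set zs. fst z \<le> B) \<and>
       mem s 6 = Sym (Inr (Opening b)) \<and>
       content (streams s 2) @ map enc (positions (fill b zs)) = map enc (positions ws))"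

lemma fill_step_runs:
  assumes "filling B n L ws (y # ys) s"
  shows "runs 3 B fill_step (tick s) (filling B n L ws ys)"
proof -
  from assms obtain b zs where s: "map snd (y # ys) = map (map_prod id Inr) zs"
    "\<forall>z \<in> set zs. fst z \<le> B" "mem s 6 = Sym (Inr (Opening b))"
    "content (streams s 2) @ map enc (positions (fill b zs)) = map enc (positions ws)"
    "calm 13 n s" "mem s 1 = Num L" "mode (streams s 1) = Reading (map enc (y # ys))"
    "mode (streams s 2) = Writing Forward"
    unfolding filling_def by blast
  from s(1) obtain k x c zs' where z: "y = (k, x, Inr c)" "zs = (x, c) # zs'"
    "map snd ys = map (map_prod id Inr) zs'"
    by (cases y; cases zs) auto
  show ?thesis
  proof (cases c)
    case (Opening a)
    show ?thesis
      using s(2-) unfolding fill_step_def filling_def z(1,2) Opening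
      by (simp add: runs_simps state_simps calm_def image_iff positions_def)
        (rule exI[of _ zs'], simp add: z(3))
  next
    case (Closing a)
    show ?thesis
      using s(2-) unfolding fill_step_def filling_def z(1,2) Closing
      by (simp add: runs_simps state_simps calm_def image_iff positions_def)
        (rule exI[of _ zs'], simp add: z(3))
  qed
qed

lemma fst_set_fill: "fst ` set (fill b zs) = fst ` set zs"
  by (induction b zs rule: fill.induct) auto

lemma fill_pass_runs:
  assumes "content (streams s 1) = map enc ys" and "map snd ys = map (map_prod id Inr) zs"
    and "\<And>z. z \<in> set zs \<Longrightarrow> fst z \<le> B" and "calm 10 n s" and "mem s 1 = Num L"
  shows "runs 3 B fill_pass s (\<lambda>s'. calm 17 (n + 4) s' \<and> mem s' 1 = Num L \<and>
     content (streams s' 1) = map enc (positions (fill undefined zs)))"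
proof -
  let ?ws = "fill undefined zs"
  have loop: "runs 3 B (While (Neg (AtEnd 1)) fill_step) s1 (\<lambda>s'. calm 14 (n + 2) s' \<and>
      mem s' 1 = Num L \<and> content (streams s' 2) = map enc (positions ?ws))"
    if "filling B (n + 2) L ?ws ys s1" for s1
  proof (rule runs_While_list[where I = "filling B (n + 2) L ?ws", OF that])
    fix y ys s assume "filling B (n + 2) L ?ws (y # ys) s"
    from fill_step_runs[OF this] this
    show "holds s (Neg (AtEnd 1)) \<and> runs 3 B fill_step (tick s) (filling B (n + 2) L ?ws ys)"
      by (simp add: filling_def)
  next
    fix s assume "filling B (n + 2) L ?ws [] s"
    then show "\<not> holds s (Neg (AtEnd 1)) \<and> calm 14 (n + 2) (tick s) \<and>
        mem (tick s) 1 = Num L \<and> content (streams (tick s) 2) = map enc (positions ?ws)"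
      by (auto simp: filling_def calm_def tick_def positions_def)
  qed
  have copy: "runs 3 B (Seq (OpenWrite 1 Forward) (Seq (OpenRead 2 Forward) (copy_loop 2))) s2
      (\<lambda>s'. calm 17 (n + 4) s' \<and> mem s' 1 = Num L \<and>
        content (streams s' 1) = map enc (positions ?ws))"
    if s2: "calm 14 (n + 2) s2" "mem s2 1 = Num L"
      "content (streams s2 2) = map enc (positions ?ws)" for s2
  proof -
    let ?s3 = "set_stream 2 \<lparr>content = map enc (positions ?ws),
        mode = Reading (map enc (positions ?ws))\<rparr> (new_pass (tick
      (set_stream 1 \<lparr>content = [], mode = Writing Forward\<rparr> (new_pass (tick s2)))))"
    have bound: "k \<le> B \<and> x \<le> B" if "(k, x, c) \<in> set (positions ?ws)" for k x c
    proof -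
      have "x \<in> fst ` set ?ws" "k = x" using that by (force simp: positions_def)+
      then show ?thesis using assms(3) by (auto simp: fst_set_fill)
    qed
    have "runs 3 B (copy_loop 2) ?s3 (\<lambda>s'. calm (Suc 16) (n + 4) s' \<and>
        mode (streams s' 1) = Writing Forward \<and>
        content (streams s' 1) = content (streams ?s3 1) @ map enc (positions ?ws) \<and>
        (\<forall>j. j \<noteq> 1 \<longrightarrow> content (streams s' j) = content (streams ?s3 j)) \<and>
        (\<forall>x. x < 3 \<longrightarrow> mem s' x = mem ?s3 x))"
      by (rule copy_loop_runs) (use s2 bound in \<open>auto simp: state_simps calm_def\<close>)
    then have "runs 3 B (copy_loop 2) ?s3 (\<lambda>s'. calm 17 (n + 4) s' \<and> mem s' 1 = Num L \<and>
        content (streams s' 1) = map enc (positions ?ws))"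
      by (rule runs_mono) (use s2 in \<open>auto simp: state_simps\<close>)
    then show ?thesis
      using s2(3) by (simp add: runs_Seq runs_OpenRead runs_OpenWrite state_simps)
  qed
  let ?s = "put (Cell 6) (Sym (Inr (Opening undefined))) (tick
    (set_stream 2 \<lparr>content = [], mode = Writing Forward\<rparr> (new_pass (tick
    (set_stream 1 \<lparr>content = map enc ys, mode = Reading (map enc ys)\<rparr> (new_pass (tick s)))))))"
  have "filling B (n + 2) L ?ws ys ?s"
    unfolding filling_def
    by (intro conjI exI[of _ undefined] exI[of _ zs])
      (use assms in \<open>auto simp: state_simps calm_def\<close>)
  then have "runs 3 B (Seq (While (Neg (AtEnd 1)) fill_step)
      (Seq (OpenWrite 1 Forward) (Seq (OpenRead 2 Forward) (copy_loop 2)))) ?s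
      (\<lambda>s'. calm 17 (n + 4) s' \<and> mem s' 1 = Num L \<and>
        content (streams s' 1) = map enc (positions ?ws))"
    by (blast intro: runs_SeqI loop copy)
  then show ?thesis
    using assms(1) unfolding fill_pass_def by (simp add: runs_Seq[of _ _ "OpenRead 1 _"]
        runs_Seq[of _ _ "OpenWrite 2 _"] runs_Seq[of _ _ "Assign _ _"] runs_OpenRead[of _ _ 1]
        runs_OpenWrite[of _ _ 2] runs_Assign in_direction_def)
qed

definition output_loop :: "'c prog" where
  "output_loop = While (Neg (AtEnd 1)) (Seq (Read 1 entry_cells) (Write 3 [At (Cell 5)]))"

lemma output_loop_runs:
  assumes "mode (streams s 1) = Reading (map enc ys)"
    and "streams s 3 = \<lparr>content = [], mode = Writing Forward\<rparr>" and "calm 21 n s"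
  shows "runs 3 B output_loop s (\<lambda>s'. calm 22 n s' \<and>
     content (streams s' 3) = map (\<lambda>(k, x, c). [Sym c]) ys)"
  unfolding output_loop_def
  by (rule runs_While_list[where xs = ys and I = "\<lambda>zs s'. calm 21 n s' \<and>
     mode (streams s' 1) = Reading (map enc zs) \<and> mode (streams s' 3) = Writing Forward \<and>
     content (streams s' 3) @ map (\<lambda>(k, x, c). [Sym c]) zs = map (\<lambda>(k, x, c). [Sym c]) ys"])
    (use assms in \<open>auto simp: runs_simps state_simps calm_def\<close>)

text \<open>Stream 3 is scratch space for the sorts and free again afterwards, so it can take the
  output.\<close>

definition decoder :: "'a letter prog" where
  "decoder =
     Seq (OpenRead 0 Forward) (Seq (OpenWrite 1 Forward) (Seq emit_loop
     (Seq radix_sort (Seq fill_pass (Seq radix_sort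
     (Seq (OpenRead 1 Forward) (Seq (OpenWrite 3 Forward) output_loop)))))))"


section \<open>The two sorts applied to lists of tags\<close>

lemma snd_mem_enumerate: "p \<in> set (enumerate n xs) \<Longrightarrow> snd p \<in> set xs"
  by (metis imageI list.set_map map_snd_enumerate)

lemma radix_sort_entries:
  assumes "\<And>d c. (d, c) \<in> set es \<Longrightarrow> d \<le> L"
  shows "map snd (radix L (entries n es)) =
    map (map_prod id Inr) (concat (map (\<lambda>k. bucket k n es) [0..<Suc L]))"
proof -
  have "fst e \<le> L" if "e \<in> set (entries n es)" for e
    using that assms by (auto simp: entries_def dest!: snd_mem_enumerate)
  moreover have "map snd [e\<leftarrow>entries n es. fst e = k] = map (map_prod id Inr) (bucket k n es)" for k
    by (induction es arbitrary: n) auto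
  ultimately show ?thesis
    by (subst map_snd_radix[of _ _ "Suc L"]) (auto simp: map_concat o_def)
qed

text \<open>Buckets are chosen by depth alone, so sorting by depth commutes with blanking the
  labels.\<close>

lemma bucket_map: "bucket k n (map (map_prod id f) es) = map (map_prod id f) (bucket k n es)"
  by (induction es arbitrary: n) auto

lemma mset_buckets:
  assumes "\<And>d c. (d, c) \<in> set es \<Longrightarrow> d < K"
  shows "mset (concat (map (\<lambda>k. bucket k 0 es) [0..<K])) = mset (enumerate 0 (map snd es))"
proof -
  let ?h = "\<lambda>(x, d, c). (x, c)"
  have "fst (snd e) < K" if "e \<in> set (enumerate 0 es)" for e
    using snd_mem_enumerate[OF that] assms[of "fst (snd e)" "snd (snd e)"] by simp
  then have "mset (concat (map (\<lambda>k. [e\<leftarrow>enumerate 0 es. fst (snd e) = k]) [0..<K])) =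
      mset (enumerate 0 es)"
    by (rule mset_concat_buckets)
  then have "mset (map ?h (concat (map (\<lambda>k. [e\<leftarrow>enumerate 0 es. fst (snd e) = k]) [0..<K]))) =
      mset (map ?h (enumerate 0 es))"
    by simp
  moreover have "map ?h (enumerate n es) = enumerate n (map snd es)" for n
    by (induction es arbitrary: n) auto
  ultimately show ?thesis
    by (simp only: bucket_def map_concat map_map o_def case_prod_unfold)
qed

text \<open>The key bound in cell 1 is the number of tags and not the largest position; the extra
  bucket is empty.\<close>

lemma radix_sort_positions:
  assumes "mset zs = mset (enumerate 0 cs)"
  shows "map snd (radix (length cs) (positions zs)) = map (map_prod id Inr) (enumerate 0 cs)"
proof -
  have "fst e \<le> length cs" if "e \<in> set (positions zs)" for e
    using that mset_eq_setD[OF assms] by (auto simp: positions_def in_set_enumerate_eq)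
  moreover have "map snd [e\<leftarrow>positions zs. fst e = k] =
      map (map_prod id Inr) [z\<leftarrow>zs. fst z = k]" for k
    by (induction zs) (auto simp: positions_def)
  ultimately have "map snd (radix (length cs) (positions zs)) =
      map (map_prod id Inr) (concat (map (\<lambda>k. [z\<leftarrow>zs. fst z = k]) [0..<Suc (length cs)]))"
    by (subst map_snd_radix[of _ _ "Suc (length cs)"]) (auto simp: map_concat o_def)
  also have "concat (map (\<lambda>k. [z\<leftarrow>zs. fst z = k]) [0..<Suc (length cs)]) = enumerate 0 cs"
    by (rule concat_buckets_permuted_enumerate) (use assms in auto)
  finally show ?thesis .
qed

text \<open>Every step down in the encoding reaches a new node, so a depth stays below the number of
  nodes.\<close>

lemma fcns_tags_less: "(d', c) \<in> set (fcns_tags d ts) \<Longrightarrow> d' < d + sum_list (map nodes ts)"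
proof (induction d ts rule: fcns_tags.induct)
  case (2 d a ts us)
  then show ?case by fastforce
qed simp

section \<open>Composition of the phases\<close>

definition stored :: "nat \<Rightarrow> nat \<Rightarrow> nat \<Rightarrow> 'c entry list \<Rightarrow> 'c state \<Rightarrow> bool" where
  "stored c n L xs s \<longleftrightarrow> calm c n s \<and> content (streams s 1) = map enc xs \<and> mem s 1 = Num L"

text \<open>The number \<open>n\<close> of tags bounds both the stored numbers and the keys. Passes:
  2 for the scan, \<open>6 * halvings n\<close> for each sort, 4 for filling, 2 for the output. The
  clock bounds after the five phases are 7, 9, 17, 19 and 22.\<close>

lemma decoder_runs:
  fixes t :: "'a::finite utree"
  defines "n \<equiv> 2 * nodes t"
  shows "runs 3 n decoder (initial (map (\<lambda>c. [Sym c]) (map Inl (xml_bin (fcns t)))))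
    (\<lambda>s. calm 22 (8 + 12 * halvings n) s \<and>
      content (streams s 3) = map (\<lambda>c. [Sym (Inr c)]) (xml t))"
proof -
  define tags where "tags = fcns_tags 0 [t]"
  define es where "es = map (map_prod id blank) tags"
  \<comment> \<open>\<open>order\<close> lists the true tags by depth; \<open>zs\<close> is what the
    first sort delivers of it, with blank closing tags.\<close>
  define order where "order = concat (map (\<lambda>k. bucket k 0 tags) [0..<Suc n])"
  define zs where "zs = map (map_prod id blank) order"
  let ?input = "map (\<lambda>c. [Sym c :: 'a letter item]) (map Inl (xml_bin (fcns t)))"
  have tags: "map snd tags = xml t"
    unfolding tags_def by (simp add: map_snd_fcns_tags)
  then have len: "length tags = n" "length es = n"
    unfolding es_def n_def using length_map[of snd tags] by (simp_all add: length_xml)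
  have emit: "emit False 0 (xml_bin (fcns t)) = es"
    unfolding es_def tags_def by (rule emit_fcns)
  have len_bin: "length (xml_bin (fcns t)) = n"
    by (simp add: length_xml_bin fcns_def size_fcns_forest n_def)
  have depth: "d < n" if "(d, c) \<in> set tags" for d c
    using fcns_tags_less[of d c 0 "[t]"] that by (auto simp: tags_def n_def)
  have n: "0 < n" by (cases t) (simp add: n_def)
  have mset_order: "mset order = mset (enumerate 0 (xml t))"
    unfolding order_def tags[symmetric] by (rule mset_buckets) (auto dest: depth)
  have order_less: "fst z < n" if "z \<in> set order" for z
    using that mset_eq_setD[OF mset_order] by (auto simp: in_set_enumerate_eq n_def length_xml)
  \<comment> \<open>Every bucket is paired and so begins with an opening tag; hence the
    concatenation is paired too, and no label leaks across a bucket border.\<close>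
  have fill: "fill undefined zs = order"
    unfolding zs_def order_def tags_def
    by (intro fill_paired paired_concat) (auto simp: paired_bucket)
  have sorted1: "map snd (radix n (entries 0 es)) = map (map_prod id Inr) zs"
  proof -
    have "d \<le> n" if "(d, c) \<in> set es" for d c
      using that depth unfolding es_def by fastforce
    then show ?thesis
      by (simp only: radix_sort_entries) (simp only: zs_def order_def es_def map_concat map_map
          o_def bucket_map)
  qed
  have sorted2: "map snd (radix n (positions order)) = map (map_prod id Inr) (enumerate 0 (xml t))"
    using radix_sort_positions[OF mset_order] by (simp add: length_xml n_def)
  have entry1: "k \<le> n \<and> x \<le> n" if kx: "(k, x, c) \<in> set (entries 0 es)" for k x c
  proof -
    obtain c' where e: "(x, k, c') \<in> set (enumerate 0 es)"
      using kx by (auto simp: entries_def)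
    then have "x < n" using len by (simp add: in_set_enumerate_eq)
    moreover obtain c'' where "(k, c'') \<in> set tags"
      using snd_mem_enumerate[OF e] by (auto simp: es_def)
    ultimately show ?thesis using depth[of k c''] by simp
  qed
  have entry2: "k \<le> n \<and> x \<le> n" if "(k, x, c) \<in> set (positions order)" for k x c
    using that order_less by (force simp: positions_def)
  have ne: "entries 0 es \<noteq> []" "positions order \<noteq> []"
    using n len mset_order length_xml[of t]
    by (auto simp: entries_def positions_def enumerate_eq_zip n_def)
  let ?h = "6 * halvings n"
  let ?R = "\<lambda>s. calm 22 (8 + 12 * halvings n) s \<and>
    content (streams s 3) = map (\<lambda>c. [Sym (Inr c)]) (xml t)"
  have out_pass: "runs 3 n (Seq (OpenRead 1 Forward) (Seq (OpenWrite 3 Forward) output_loop)) s ?R"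
    if "stored 19 (6 + ?h + ?h) n (radix n (positions order)) s" for s
  proof -
    let ?ys = "radix n (positions order)"
    let ?s = "set_stream 3 \<lparr>content = [], mode = Writing Forward\<rparr> (new_pass (tick
      (set_stream 1 \<lparr>content = map enc ?ys, mode = Reading (map enc ?ys)\<rparr> (new_pass (tick s)))))"
    have "map (\<lambda>(k, x, c). [Sym c]) ?ys = map (\<lambda>(x, c). [Sym c]) (map snd ?ys)"
      by (simp add: case_prod_unfold)
    also have "\<dots> = map (\<lambda>c. [Sym (Inr c)]) (map snd (enumerate 0 (xml t)))"
      unfolding sorted2 by (simp add: case_prod_unfold del: map_snd_enumerate)
    finally have out: "map (\<lambda>(k, x, c). [Sym c]) ?ys = map (\<lambda>c. [Sym (Inr c)]) (xml t)"
      by simp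
    have "runs 3 n output_loop ?s (\<lambda>s'. calm 22 (8 + 12 * halvings n) s' \<and>
        content (streams s' 3) = map (\<lambda>(k, x, c). [Sym c]) ?ys)"
      by (rule output_loop_runs) (use that in \<open>auto simp: stored_def state_simps calm_def\<close>)
    then show ?thesis
      unfolding out
      using that by (simp add: runs_Seq runs_OpenRead runs_OpenWrite in_direction_def stored_def)
  qed
  have sort2: "runs 3 n radix_sort s (stored 19 (6 + ?h + ?h) n (radix n (positions order)))"
    if "stored 17 (6 + ?h) n (positions order) s" for s
    by (rule runs_mono[OF radix_sort_runs[where c = 17 and n = "6 + ?h"
          and xs = "positions order"]])
      (use that n ne entry2 in \<open>auto simp: stored_def\<close>)
  have refill: "runs 3 n fill_pass s (stored 17 (6 + ?h) n (positions order))"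
    if "stored 9 (2 + ?h) n (radix n (entries 0 es)) s" for s
  proof -
    have "fst z \<le> n" if "z \<in> set zs" for z
      using that order_less by (fastforce simp: zs_def)
    with that have "runs 3 n fill_pass s (\<lambda>s'. calm 17 (2 + ?h + 4) s' \<and> mem s' 1 = Num n \<and>
        content (streams s' 1) = map enc (positions (fill undefined zs)))"
      by (intro fill_pass_runs[OF _ sorted1]) (auto simp: stored_def calm_def)
    then show ?thesis
      by (rule runs_mono) (simp add: stored_def fill add.commute)
  qed
  have sort1: "runs 3 n radix_sort s (stored 9 (2 + ?h) n (radix n (entries 0 es)))"
    if "stored 7 2 n (entries 0 es) s" for s
    by (rule runs_mono[OF radix_sort_runs[where c = 7 and n = 2 and xs = "entries 0 es"]])
      (use that n ne entry1 in \<open>auto simp: stored_def\<close>)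
  let ?s = "set_stream 1 \<lparr>content = [], mode = Writing Forward\<rparr> (new_pass (tick
    (set_stream 0 \<lparr>content = ?input, mode = Reading ?input\<rparr> (new_pass (tick (initial ?input))))))"
  have "emitting n 2 es (xml_bin (fcns t)) ?s"
    unfolding emitting_def
    by (intro conjI exI[of _ False] exI[of _ 0])
      (auto simp: state_simps calm_def initial_def emit len_bin)
  then have "runs 3 n emit_loop ?s (stored 7 2 n (entries 0 es))"
    by (rule runs_mono[OF emit_loop_runs]) (simp_all add: len stored_def)
  then have "runs 3 n (Seq emit_loop
      (Seq radix_sort (Seq fill_pass (Seq radix_sort
      (Seq (OpenRead 1 Forward) (Seq (OpenWrite 3 Forward) output_loop)))))) ?s ?R"
    by (blast intro: runs_SeqI sort1 refill sort2 out_pass)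
  moreover have "content (streams (initial ?input) 0) = ?input"
    by (simp add: initial_def)
  ultimately show ?thesis
    unfolding decoder_def by (simp add: runs_Seq[of _ _ "OpenRead 0 _"] runs_Seq[of _ _ "OpenWrite 1 _"]
        runs_OpenRead[of _ _ 0] runs_OpenWrite[of _ _ 1] in_direction_def)
qed

section \<open>Asymptotic bounds\<close>

theorem theorem7:
  shows "\<exists>(P :: 'a::finite letter prog) (p :: nat \<Rightarrow> real) (sp :: nat \<Rightarrow> real) (\<tau> :: nat \<Rightarrow> real).
    p \<in> O(\<lambda>N. ln (real N)) \<and>
    sp \<in> O(\<lambda>N. (ln (real N))\<^sup>2) \<and>
    \<tau> \<in> O(\<lambda>N. ln (real N)) \<and>
    streaming_algorithm P 3 p sp \<tau> (UNIV :: 'a utree set) nodes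
      (\<lambda>t. map Inl (xml_bin (fcns t))) 3 (\<lambda>t. map Inr (xml t))"
proof (intro exI conjI)
  \<comment> \<open>\<open>halvings (2 * N)\<close> is at most \<open>1 + log 2 (2 * N)\<close>.
    Each of the seven cells costs one for the letter plus a logarithm whose rounding up adds at most
    one. The processing time is even constant.\<close>
  let ?p = "\<lambda>N. 8 + 12 * (1 + log 2 (real (2 * N)))"
  let ?sp = "\<lambda>N. 7 * (2 + log 2 (real (2 * N + 1)))"
  let ?\<tau> = "\<lambda>N :: nat. 40 :: real"
  show "?p \<in> O(\<lambda>N. ln (real N))"
    unfolding log_def by real_asymp
  show "?sp \<in> O(\<lambda>N. (ln (real N))\<^sup>2)"
    unfolding log_def by real_asymp
  show "?\<tau> \<in> O(\<lambda>N. ln (real N))"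
    by real_asymp
  show "streaming_algorithm decoder 3 ?p ?sp ?\<tau> (UNIV :: 'a utree set) nodes
      (\<lambda>t. map Inl (xml_bin (fcns t))) 3 (\<lambda>t. map Inr (xml t))"
    unfolding streaming_algorithm_def Let_def
  proof
    fix t :: "'a utree"
    let ?n = "2 * nodes t"
    obtain s where s: "exec 3 ?n decoder
        (initial (map (\<lambda>c. [Sym c]) (map Inl (xml_bin (fcns t))))) s"
      "calm 22 (8 + 12 * halvings ?n) s"
      "content (streams s 3) = map (\<lambda>c. [Sym (Inr c)]) (xml t)"
      using decoder_runs[of t] unfolding runs_def by blast
    have "real (halvings ?n) \<le> 1 + log 2 (real ?n)"
      by (rule halvings_le_log) (cases t, simp)
    then have "real (passes s) \<le> ?p (nodes t)"
      using s(2) by (simp add: calm_def)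
    moreover have "real (space ?n s) \<le> ?sp (nodes t)"
    proof -
      let ?b = "log 2 (real (?n + 1))"
      define b where "b = nat \<lceil>?b\<rceil>"
      have "0 \<le> ?b" by (subst zero_le_log_cancel_iff) auto
      then have "1 + real b \<le> 2 + ?b" unfolding b_def by linarith
      moreover have "real (top s) \<le> 7" using s(2) by (simp add: calm_def)
      ultimately have "real (top s) * (1 + real b) \<le> 7 * (2 + ?b)"
        by (intro mult_mono) simp_all
      moreover have "real (space ?n s) = real (top s) * (1 + real b)"
        by (simp only: space_def b_def of_nat_mult of_nat_add of_nat_1)
      ultimately show ?thesis by simp
    qed
    moreover have "real (delay s) \<le> 40" using s(2) by (simp add: calm_def)
    ultimately show "\<exists>s. exec 3 ?n decoder
          (initial (map (\<lambda>c. [Sym c]) (map Inl (xml_bin (fcns t))))) s \<and>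
        content (streams s 3) = map (\<lambda>c. [Sym c]) (map Inr (xml t)) \<and>
        real (passes s) \<le> ?p (nodes t) \<and> real (space ?n s) \<le> ?sp (nodes t) \<and>
        real (delay s) \<le> ?\<tau> (nodes t)"
      using s(1,3) by (intro exI[of _ s]) (simp add: o_def)
  qed
qed

end
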